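(* Let $\tau$ be a tape produced by the certification protocol with configuration $c$, single-use nonce $\nu$, initial state $(\theta_0,s_0)$ and declared transition function $f$, and let $\theta_f$ be a checkpoint. Then $$\Pr\left[V\left(\tau,c,\nu,\theta_0,s_0,\mathcal H_{\mathrm{func}}(f),\theta_f\right)=1 \;\middle|\; I_f(\tau)=0,\ \theta_f\in\tau\right]=1 .$$
   Context: **Training.** An $n$-step run has parameter states $\theta_0,\dots,\theta_n\in\Theta$, optimizer states $s_0,\dots,s_n\in S$ and data batches $d_0,\dots,d_{n-1}\in D$ (random seeds are part of $s_i$ or $d_i$). The declared transition is a deterministic function $f:\Theta\times S\times D\to\Theta\times S$. The trainer $A$ is untrusted; a trusted attestation engine $B_{\mathrm{att}}$ computes the records. The configuration $c$ includes a check probability $p_{\mathrm{check}}$, a sketch fraction $p_{\mathrm{sketch}}\in(0,1]$, a number of hashing rounds $T$, a number $q$ of checkpoint samples, and cryptographic parameters. For a tape $\tau$ recording transitions $(\theta_i,s_i,d_i)\mapsto(\theta_{i+1},s_{i+1})$, $$I_f(\tau)=\left|\{i\in\{0,\dots,n-1\}: (\theta_{i+1},s_{i+1})\ne f(\theta_i,s_i,d_i)\}\right| .$$ $\theta_f\in\tau$ means that $\theta_f$ is bound to some checkpoint record of $\tau$. **Hashes.** All $\mathcal H_*$ are deterministic, domain-separated cryptographic hashes (stamped with session material of $B_{\mathrm{att}}$); $\operatorname{ser}$ is an injective serialization; $\operatorname{PRNG}$ maps bit strings to $[0,1]$ (or to sampled positions) deterministically. **Parameter sketch $C_\theta$.**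 Parameters are split into matrix leaves $\theta^{(1)},\dots,\theta^{(m)}$, leaf $j$ having rows in $\mathbb R^{d_j}$. Put $l_j=\min\{\max\{\lceil p_{\mathrm{sketch}}d_j\rceil,1\},d_j\}$ and fix $Q_j\in\mathbb R^{d_j\times l_j}$ with $Q_j^TQ_j=I_{l_j}$. With $C^{(0)}=\bot$, for $j=1,\dots,m$ set $C^{(j)}=\mathcal H_{\mathrm{sketch}}\left(\mathcal H_{\mathrm{sketch}}(i,j,\operatorname{vec}(\theta_i^{(j)}Q_j)),C^{(j-1)}\right)$; then $C_\theta(\theta_i)=C^{(m)}$. **Optimizer hash $C_s$.** Let $W$ be an injective map from admissible floats to $\{0,\dots,2^{31}-1\}$. For each boundary state $s_i$, leaf $j$, round $t\le T$ and coordinate $r$, $B_{\mathrm{att}}$ samples hidden independent uniform odd $a_{j,t,r}\in\mathbb Z_{2^{32}}^\times$ and uniform $b_{j,t,r}\in\mathbb Z_{2^{32}}$ (the same family is used for both copies of $s_i$, namely the post-state of update $i-1$ and the pre-state of update $i$). Then $h_{j,t}(s_i)=\sum_r a_{j,t,r}\left[W(s_i^{(j)})_r\oplus(ra_{j,t,r}+b_{j,t,r})\right]\bmod 2^{32}$ ($\oplus$ is bitwise XOR), and $C_s(s_i)=\mathcal H_{\mathrm{state}}(h_{1,1}(s_i),\dots,h_{m,T}(s_i))$ (256-bit digest). **Data commitment.** $C_d(d_i)=\mathcal H_d(\operatorname{ser}(d_i))$; $F_d(d_i)$ is the list of polynomial rolling hashes of all length-$L$ token windows of $d_i$. **Tape.**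 The payloads are a root record $R$ (containing session metadata, $\nu$, $c$, $\mathcal H_{\mathrm{init}}(\operatorname{ser}(\theta_0,s_0))$, $\mathcal H_{\mathrm{func}}(f)$ and the first verification key $\mathrm{vk}_0$, signed by a stable root-of-trust key), a measurement record of the prover program, and update records $u_0,\dots,u_{n-1}$. Each payload $\bar\tau_i$ is chained as $\tau_i=(\bar\tau_i,\mathcal H_{\mathrm{record}}(\tau_{i-1}),\mathrm{vk}_{i+1},\sigma_i)$, where $\sigma_i$ is a signature under $\mathrm{sk}_i$ of the hash of the other three entries, and $(\mathrm{sk}_{i+1},\mathrm{vk}_{i+1})=\operatorname{KeyGen}(\mathcal H_{\mathrm{ratchet}}(\mathrm{sk}_i))$; each key signs once. Update record $u_i$ consists of: (1) $u_i^{(1)}=(C_\theta(\theta_i),C_s(s_i),C_d(d_i),F_d(d_i))$; (2) $u_i^{(2)}=(C_\theta(\theta_{i+1}),C_s(s_{i+1}))$ for the outputs declared by $A$; (3) $u_i^{(3)}=\operatorname{PRNG}[\mathcal H_{\mathrm{record}}(\nu,\tau_{i-1},u_i^{(1)},u_i^{(2)})]$; the update is challenged iff this is $\le p_{\mathrm{check}}$; (4) if challenged, $(\theta'_{i+1},s'_{i+1})=f(\theta_i,s_i,d_i)$ is recomputed, $C_\theta(\theta'_{i+1})$ and the full $s'_{i+1}$ are compared with the committed values, and for one uniformly sampled parameter position $x$ the pair $u_i^{(4)}=(\theta_{i+1}^{(x)},\theta_{i+1}'^{(x)})$ is recorded; (5) if a checkpoint is released, $h_i^{\mathrm{ckpt}}=\mathcal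 H_{\mathrm{ckpt}}(\operatorname{ser}(\nu,\tau_{i-1},u_i^{(1)},\dots,u_i^{(4)},\theta_{i+1}))$ and the values of $\theta_{i+1}$ at $q$ positions sampled by $\operatorname{PRNG}[\mathcal H_{\mathrm{record}}(h_i^{\mathrm{ckpt}})]$ are recorded. **Verifier.** $V(\tau,c,\nu,\theta_0,s_0,\mathcal H_{\mathrm{func}}(f),\theta_f)\in\{0,1\}$ outputs $1$ iff all these checks pass: $V_{\mathrm{sig}}$ (root attestation and session keys valid for the known $B_{\mathrm{att}}$); $V_{\mathrm{bind}}$ ($C_\theta(\theta_f)$ occurs in the tape, $h_i^{\mathrm{ckpt}}$ recomputed from $\theta_f$ occurs in the tape, and the recorded sampled values match $\theta_f$); $V_{\mathrm{func}}$ ($\mathcal H_{\mathrm{func}}(f)$ is in $\tau$ with valid attestation); $V_{\mathrm{tape}}$ (hash chain and ratcheted signatures valid, first record bound to $(\nu,\theta_0,s_0)$, and the post parameter/optimizer commitments of $u_i$ equal the pre commitments of $u_{i+1}$ for all $i\le n-2$); $V_{\mathrm{replay}}$ (challenge derivations are correct and, for challenged updates, the replayed parameter sketch, full optimizer state and sampled parameter value agree with the committed ones, with the replayed function matching $\mathcal H_{\mathrm{func}}(f)$). *)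

theory Defs
  imports
    "HOL-Probability.Probability"
    "HOL-Probability.Product_PMF"
    "HOL-Library.Word"
    "Jordan_Normal_Form.Matrix"
begin

text \<open>
  Attested training: the certification protocol is a probabilistic program (a \<^typ>\<open>'a pmf\<close>) in
  which a trusted engine interacts with an arbitrary, adaptive and randomised trainer.  Leaves,
  rounds, coordinates and positions are indexed from 0.
\<close>

section \<open>Parameters, configuration, tape\<close>

type_synonym bits = "bool list"
type_synonym params = "real mat list"
type_synonym position = "nat \<times> nat \<times> nat"  \<comment> \<open>leaf, row, column\<close>
type_synonym ('s, 'd) transition = "params \<times> 's \<times> 'd \<Rightarrow> params \<times> 's"

record ('s, 'd) model =
  leaves :: nat                              \<comment> \<open>\<open>m\<close>\<close>
  nrows :: "nat \<Rightarrow> nat"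
  ncols :: "nat \<Rightarrow> nat"                       \<comment> \<open>\<open>d_j\<close>\<close>
  Params :: "params set"                     \<comment> \<open>\<open>\<Theta>\<close>\<close>
  States :: "'s set"                         \<comment> \<open>\<open>S\<close>\<close>
  Batches :: "'d set"                        \<comment> \<open>\<open>D\<close>\<close>
  ncoords :: "nat \<Rightarrow> nat"                     \<comment> \<open>number of coordinates of optimizer leaf \<open>j\<close>\<close>
  opt_leaf :: "'s \<Rightarrow> nat \<Rightarrow> real list"         \<comment> \<open>\<open>s\<^sup>(\<^sup>j\<^sup>)\<close>\<close>
  floats :: "real set"                       \<comment> \<open>admissible floats\<close>
  W :: "real \<Rightarrow> nat"
  tokens :: "'d \<Rightarrow> nat list"

definition valid_model :: "('s, 'd) model \<Rightarrow> bool" where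
  "valid_model M \<longleftrightarrow>
     0 < leaves M \<and>
     (\<forall>j < leaves M. 0 < nrows M j \<and> 0 < ncols M j) \<and>
     (\<forall>\<theta> \<in> Params M. length \<theta> = leaves M \<and>
        (\<forall>j < leaves M. \<theta> ! j \<in> carrier_mat (nrows M j) (ncols M j))) \<and>
     (\<forall>s \<in> States M. \<forall>j < leaves M.
        length (opt_leaf M s j) = ncoords M j \<and> set (opt_leaf M s j) \<subseteq> floats M) \<and>
     inj_on (W M) (floats M) \<and> W M ` floats M \<subseteq> {0..2 ^ 31 - 1}"

definition positions :: "('s, 'd) model \<Rightarrow> position set" where
  "positions M = {(j, a, b). j < leaves M \<and> a < nrows M j \<and> b < ncols M j}"

definition param_at :: "params \<Rightarrow> position \<Rightarrow> real" where
  "param_at \<theta> = (\<lambda>(j, a, b). \<theta> ! j $$ (a, b))"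

record config =
  p_check :: real
  p_sketch :: real
  rounds :: nat                              \<comment> \<open>\<open>T\<close>\<close>
  nsamples :: nat                            \<comment> \<open>\<open>q\<close>\<close>
  sketch_mat :: "nat \<Rightarrow> real mat"             \<comment> \<open>\<open>Q_j\<close>\<close>
  window :: nat                              \<comment> \<open>\<open>L\<close>\<close>
  roll_base :: nat
  roll_mod :: nat
  crypto_params :: bits

definition sketch_dim :: "('s, 'd) model \<Rightarrow> config \<Rightarrow> nat \<Rightarrow> nat" where
  "sketch_dim M c j = min (max (nat \<lceil>p_sketch c * real (ncols M j)\<rceil>) 1) (ncols M j)"

definition valid_config :: "('s, 'd) model \<Rightarrow> config \<Rightarrow> bool" where
  "valid_config M c \<longleftrightarrow>
     0 \<le> p_check c \<and> p_check c \<le> 1 \<and> 0 < p_sketch c \<and> p_sketch c \<le> 1 \<and>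
     (\<forall>j < leaves M.
        sketch_mat c j \<in> carrier_mat (ncols M j) (sketch_dim M c j) \<and>
        transpose_mat (sketch_mat c j) * sketch_mat c j = 1\<^sub>m (sketch_dim M c j))"

text \<open>A parameter sketch is an option because its recursion starts from \<open>\<bottom>\<close>, encoded as None.\<close>

type_synonym sketch = "bits option"
type_synonym state_digest = "256 word"
type_synonym pre_commit = "sketch \<times> state_digest \<times> bits \<times> nat list"
type_synonym post_commit = "sketch \<times> state_digest"

text \<open>
  Result of replaying a challenged update.  The verifier sees nothing but the tape, so besides the
  sampled pair of parameter values the engine records the replayed sketch, the outcome of its
  comparison of the full optimizer states, and the hash of the function it replayed.
\<close>

datatype replay = Replay
  (rp_sketch: sketch)
  (rp_state_agrees: bool)
  (rp_pair: "real \<times> real")                   \<comment> \<open>declared value, replayed value\<close>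
  (rp_func: bits)

text \<open>The components \<open>u1\<close>, \<open>u2\<close>, \<open>u3\<close>, \<open>u4\<close> and the checkpoint hash with its sampled values.\<close>

datatype update = UpdateRec
  (u1: pre_commit) (u2: post_commit) (u3: real) (u4: "replay option")
  (ckpt: "(bits \<times> real list) option")

datatype root_body = RootBody
  (root_session: bits) (root_nonce: bits) (root_config: config)
  (root_init: bits) (root_func: bits) (root_vk0: bits)

datatype payload =
    Root (root_of: root_body) (root_sig: bits)
  | Measurement (measurement_of: bits)
  | Update (update_of: update)

text \<open>
  Every payload, including the root record, is chained.  The root record has no predecessor, and
  its predecessor hash is None.
\<close>

datatype chained = Chained
  (payload_of: payload) (prev_hash: "bits option") (next_vk: bits) (sig_of: bits)

type_synonym tape = "chained list"

definition updates :: "tape \<Rightarrow> update list" where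
  "updates \<tau> = map (update_of \<circ> payload_of) (drop 2 \<tau>)"


section \<open>Cryptographic primitives\<close>

datatype sketch_input = SketchLeaf nat nat "real list" | SketchLink bits sketch

datatype record_input =
    HashRecord chained
  | HashChallenge bits chained pre_commit post_commit
  | HashCkpt bits

datatype ('s, 'd) ser_input =
    SerInit params 's
  | SerBatch 'd
  | SerCkpt bits chained pre_commit post_commit real "replay option" params

text \<open>
  Each hash is a function of its own, which gives domain separation; its first argument is the
  session material.  Serialized strings form an abstract type \<open>'b\<close>: real numbers occur in the
  payloads, so an injection into bit strings need not exist.  Signing may be randomised.
\<close>

record ('s, 'd, 'b) primitives =
  ser :: "('s, 'd) ser_input \<Rightarrow> 'b"
  h_sketch :: "bits \<Rightarrow> sketch_input \<Rightarrow> bits"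
  h_state :: "bits \<Rightarrow> 32 word list \<Rightarrow> state_digest"
  h_data :: "bits \<Rightarrow> 'b \<Rightarrow> bits"
  h_init :: "bits \<Rightarrow> 'b \<Rightarrow> bits"
  h_ckpt :: "bits \<Rightarrow> 'b \<Rightarrow> bits"
  h_func :: "bits \<Rightarrow> ('s, 'd) transition \<Rightarrow> bits"
  h_measure :: "bits \<Rightarrow> bits \<Rightarrow> bits"
  h_record :: "bits \<Rightarrow> record_input \<Rightarrow> bits"
  h_root :: "bits \<Rightarrow> root_body \<Rightarrow> bits"
  h_sign :: "bits \<Rightarrow> payload \<times> bits option \<times> bits \<Rightarrow> bits"
  h_ratchet :: "bits \<Rightarrow> bits \<Rightarrow> bits"
  prng_unit :: "bits \<Rightarrow> real"
  prng_positions :: "bits \<Rightarrow> nat \<Rightarrow> position list"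
  keygen :: "bits \<Rightarrow> bits \<times> bits"             \<comment> \<open>seed to \<open>(sk, vk)\<close>\<close>
  sign :: "bits \<Rightarrow> bits \<Rightarrow> bits pmf"          \<comment> \<open>\<open>sk\<close>, message\<close>
  verify :: "bits \<Rightarrow> bits \<Rightarrow> bits \<Rightarrow> bool"     \<comment> \<open>\<open>vk\<close>, message, signature\<close>
  seed_dist :: "bits pmf"                    \<comment> \<open>seed of the first session key\<close>
  root_sk :: bits                            \<comment> \<open>stable root-of-trust key of the engine\<close>
  root_vk :: bits

definition valid_primitives :: "('s, 'd) model \<Rightarrow> ('s, 'd, 'b) primitives \<Rightarrow> bool" where
  "valid_primitives M P \<longleftrightarrow>
     inj (ser P) \<and>
     (\<forall>x. prng_unit P x \<in> {0..1}) \<and>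
     (\<forall>x q. length (prng_positions P x q) = q \<and> set (prng_positions P x q) \<subseteq> positions M) \<and>
     (\<forall>seed msg. \<forall>\<sigma> \<in> set_pmf (sign P (fst (keygen P seed)) msg).
        verify P (snd (keygen P seed)) msg \<sigma>) \<and>
     (\<forall>msg. \<forall>\<sigma> \<in> set_pmf (sign P (root_sk P) msg). verify P (root_vk P) msg \<sigma>)"


section \<open>Commitments\<close>

text \<open>\<open>vec\<close>, by column stacking.\<close>

definition vec_of_mat :: "real mat \<Rightarrow> real list" where
  "vec_of_mat A = concat (map list_of_vec (cols A))"

primrec sketch_upto ::
  "('s, 'd, 'b) primitives \<Rightarrow> bits \<Rightarrow> config \<Rightarrow> nat \<Rightarrow> params \<Rightarrow> nat \<Rightarrow> sketch" where
  "sketch_upto P ses c i \<theta> 0 = None"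
| "sketch_upto P ses c i \<theta> (Suc j) =
     Some (h_sketch P ses (SketchLink
       (h_sketch P ses (SketchLeaf i j (vec_of_mat (\<theta> ! j * sketch_mat c j))))
       (sketch_upto P ses c i \<theta> j)))"

text \<open>\<open>C\<^sub>\<theta>\<close> at boundary index \<open>i\<close>, which enters the hash.\<close>

definition C_theta ::
  "('s, 'd) model \<Rightarrow> ('s, 'd, 'b) primitives \<Rightarrow> bits \<Rightarrow> config \<Rightarrow> nat \<Rightarrow> params \<Rightarrow> sketch" where
  "C_theta M P ses c i \<theta> = sketch_upto P ses c i \<theta> (leaves M)"

text \<open>Hidden pairs \<open>(a, b)\<close>, indexed by boundary state, leaf, round and coordinate.\<close>

type_synonym hidden = "nat \<times> nat \<times> nat \<times> nat \<Rightarrow> 32 word \<times> 32 word"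

definition hidden_index :: "('s, 'd) model \<Rightarrow> config \<Rightarrow> nat \<Rightarrow> (nat \<times> nat \<times> nat \<times> nat) set" where
  "hidden_index M c n =
     {(i, j, t, r). i \<le> n \<and> j < leaves M \<and> t < rounds c \<and> r < ncoords M j}"

definition hidden_pmf :: "('s, 'd) model \<Rightarrow> config \<Rightarrow> nat \<Rightarrow> hidden pmf" where
  "hidden_pmf M c n =
     Pi_pmf (hidden_index M c n) (0, 0)
       (\<lambda>_. pair_pmf (pmf_of_set {a. odd a}) (pmf_of_set UNIV))"

text \<open>Arithmetic in \<^typ>\<open>32 word\<close> is arithmetic modulo \<open>2^32\<close>.\<close>

definition opt_hash :: "('s, 'd) model \<Rightarrow> hidden \<Rightarrow> nat \<Rightarrow> 's \<Rightarrow> nat \<Rightarrow> nat \<Rightarrow> 32 word" where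
  "opt_hash M H i s j t =
     (\<Sum>r < length (opt_leaf M s j).
        let (a, b) = H (i, j, t, r)
        in a * xor (of_nat (W M (opt_leaf M s j ! r))) (of_nat r * a + b))"

definition C_s ::
  "('s, 'd) model \<Rightarrow> ('s, 'd, 'b) primitives \<Rightarrow> bits \<Rightarrow> config \<Rightarrow> hidden \<Rightarrow> nat \<Rightarrow> 's
     \<Rightarrow> state_digest" where
  "C_s M P ses c H i s =
     h_state P ses [opt_hash M H i s j t. j \<leftarrow> [0..<leaves M], t \<leftarrow> [0..<rounds c]]"

definition C_d :: "('s, 'd, 'b) primitives \<Rightarrow> bits \<Rightarrow> 'd \<Rightarrow> bits" where
  "C_d P ses d = h_data P ses (ser P (SerBatch d))"

definition rolling_hash :: "config \<Rightarrow> nat list \<Rightarrow> nat" where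
  "rolling_hash c w = (\<Sum>k < length w. w ! k * roll_base c ^ (length w - 1 - k)) mod roll_mod c"

definition F_d :: "('s, 'd) model \<Rightarrow> config \<Rightarrow> 'd \<Rightarrow> nat list" where
  "F_d M c d =
     map (\<lambda>k. rolling_hash c (take (window c) (drop k (tokens M d))))
       [0..<length (tokens M d) + 1 - window c]"


section \<open>Producing a tape\<close>

text \<open>
  A run is the list of transitions submitted to the engine (\<open>n + 1\<close> parameter and optimizer states,
  \<open>n\<close> batches) together with the tape recording them.
\<close>

record ('s, 'd) run =
  thetas :: "params list"
  opts :: "'s list"
  batches :: "'d list"
  run_tape :: tape

text \<open>
  The untrusted trainer chooses the next batch and declares the next states from everything it has
  seen (its own submissions and the tape).  After the challenge phase it decides, on seeing the
  update record so far, whether to release a checkpoint; in the record shown to it the checkpoint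
  entry is None, and in the run shown to it the new transition is already appended.
\<close>

record ('s, 'd) trainer =
  declare_next :: "('s, 'd) run \<Rightarrow> ('d \<times> params \<times> 's) pmf"
  release_ckpt :: "('s, 'd) run \<Rightarrow> update \<Rightarrow> bool pmf"

definition admissible_trainer :: "('s, 'd) model \<Rightarrow> ('s, 'd) trainer \<Rightarrow> bool" where
  "admissible_trainer M A \<longleftrightarrow>
     (\<forall>R. set_pmf (declare_next A R) \<subseteq> Batches M \<times> Params M \<times> States M)"

text \<open>The ratcheted session keys \<open>(sk\<^sub>k, vk\<^sub>k)\<close>.\<close>

primrec session_key :: "('s, 'd, 'b) primitives \<Rightarrow> bits \<Rightarrow> bits \<Rightarrow> nat \<Rightarrow> bits \<times> bits" where
  "session_key P ses seed 0 = keygen P seed"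
| "session_key P ses seed (Suc k) = keygen P (h_ratchet P ses (fst (session_key P ses seed k)))"

definition link_hash :: "('s, 'd, 'b) primitives \<Rightarrow> bits \<Rightarrow> tape \<Rightarrow> bits option" where
  "link_hash P ses \<tau> = (if \<tau> = [] then None else Some (h_record P ses (HashRecord (last \<tau>))))"

definition append_record ::
  "('s, 'd, 'b) primitives \<Rightarrow> bits \<Rightarrow> bits \<Rightarrow> payload \<Rightarrow> tape \<Rightarrow> tape pmf" where
  "append_record P ses seed p \<tau> =
     (let h = link_hash P ses \<tau>;
          sk = fst (session_key P ses seed (length \<tau>));
          vk' = snd (session_key P ses seed (Suc (length \<tau>)))
      in do {
        \<sigma> \<leftarrow> sign P sk (h_sign P ses (p, h, vk'));
        return_pmf (\<tau> @ [Chained p h vk' \<sigma>])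
      })"

definition challenge_value ::
  "('s, 'd, 'b) primitives \<Rightarrow> bits \<Rightarrow> bits \<Rightarrow> chained \<Rightarrow> pre_commit \<Rightarrow> post_commit \<Rightarrow> real" where
  "challenge_value P ses \<nu> prev c1 c2 =
     prng_unit P (h_record P ses (HashChallenge \<nu> prev c1 c2))"

definition ckpt_hash ::
  "('s, 'd, 'b) primitives \<Rightarrow> bits \<Rightarrow> bits \<Rightarrow> chained \<Rightarrow> update \<Rightarrow> params \<Rightarrow> bits" where
  "ckpt_hash P ses \<nu> prev u \<theta> =
     h_ckpt P ses (ser P (SerCkpt \<nu> prev (u1 u) (u2 u) (u3 u) (u4 u) \<theta>))"

definition ckpt_samples ::
  "('s, 'd, 'b) primitives \<Rightarrow> bits \<Rightarrow> config \<Rightarrow> bits \<Rightarrow> params \<Rightarrow> real list" where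
  "ckpt_samples P ses c h \<theta> =
     map (param_at \<theta>) (prng_positions P (h_record P ses (HashCkpt h)) (nsamples c))"

definition replay_update ::
  "('s, 'd) model \<Rightarrow> ('s, 'd, 'b) primitives \<Rightarrow> config \<Rightarrow> bits \<Rightarrow> ('s, 'd) transition \<Rightarrow> nat
     \<Rightarrow> params \<times> 's \<times> 'd \<Rightarrow> params \<times> 's \<Rightarrow> replay pmf" where
  "replay_update M P c ses f i pre post =
     (let (\<theta>1, s1) = post; (\<theta>', s') = f pre
      in do {
        x \<leftarrow> pmf_of_set (positions M);
        return_pmf (Replay (C_theta M P ses c (Suc i) \<theta>') (s' = s1)
                           (param_at \<theta>1 x, param_at \<theta>' x) (h_func P ses f))
      })"

text \<open>
  Update \<open>i\<close>.  The hidden family indexed by \<open>Suc i\<close> hashes the post-state of this update and the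
  pre-state of the next one.
\<close>

definition update_step ::
  "('s, 'd) model \<Rightarrow> ('s, 'd, 'b) primitives \<Rightarrow> config \<Rightarrow> bits \<Rightarrow> bits \<Rightarrow> ('s, 'd) transition
     \<Rightarrow> ('s, 'd) trainer \<Rightarrow> bits \<Rightarrow> hidden \<Rightarrow> nat \<Rightarrow> ('s, 'd) run \<Rightarrow> ('s, 'd) run pmf" where
  "update_step M P c ses \<nu> f A seed H i R =
     do {
       (d, \<theta>1, s1) \<leftarrow> declare_next A R;
       let \<theta> = last (thetas R);
       let s = last (opts R);
       let prev = last (run_tape R);
       let c1 = (C_theta M P ses c i \<theta>, C_s M P ses c H i s, C_d P ses d, F_d M c d);
       let c2 = (C_theta M P ses c (Suc i) \<theta>1, C_s M P ses c H (Suc i) s1);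
       let v = challenge_value P ses \<nu> prev c1 c2;
       rp \<leftarrow> (if v \<le> p_check c
              then map_pmf Some (replay_update M P c ses f i (\<theta>, s, d) (\<theta>1, s1))
              else return_pmf None);
       let R' = R\<lparr>thetas := thetas R @ [\<theta>1], opts := opts R @ [s1], batches := batches R @ [d]\<rparr>;
       let u = UpdateRec c1 c2 v rp None;
       released \<leftarrow> release_ckpt A R' u;
       let h = ckpt_hash P ses \<nu> prev u \<theta>1;
       let k = (if released then Some (h, ckpt_samples P ses c h \<theta>1) else None);
       \<tau> \<leftarrow> append_record P ses seed (Update (UpdateRec c1 c2 v rp k)) (run_tape R);
       return_pmf (R'\<lparr>run_tape := \<tau>\<rparr>)
     }"

definition start_session ::
  "('s, 'd, 'b) primitives \<Rightarrow> config \<Rightarrow> bits \<Rightarrow> bits \<Rightarrow> bits \<Rightarrow> ('s, 'd) transition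
     \<Rightarrow> params \<Rightarrow> 's \<Rightarrow> bits \<Rightarrow> ('s, 'd) run pmf" where
  "start_session P c ses prog \<nu> f \<theta>0 s0 seed =
     do {
       let body = RootBody ses \<nu> c (h_init P ses (ser P (SerInit \<theta>0 s0))) (h_func P ses f)
                    (snd (session_key P ses seed 0));
       \<sigma> \<leftarrow> sign P (root_sk P) (h_root P ses body);
       \<tau> \<leftarrow> append_record P ses seed (Root body \<sigma>) [];
       \<tau>' \<leftarrow> append_record P ses seed (Measurement (h_measure P ses prog)) \<tau>;
       return_pmf \<lparr>thetas = [\<theta>0], opts = [s0], batches = [], run_tape = \<tau>'\<rparr>
     }"

primrec run_updates ::
  "('s, 'd) model \<Rightarrow> ('s, 'd, 'b) primitives \<Rightarrow> config \<Rightarrow> bits \<Rightarrow> bits \<Rightarrow> ('s, 'd) transition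
     \<Rightarrow> ('s, 'd) trainer \<Rightarrow> bits \<Rightarrow> hidden \<Rightarrow> ('s, 'd) run \<Rightarrow> nat \<Rightarrow> ('s, 'd) run pmf" where
  "run_updates M P c ses \<nu> f A seed H R 0 = return_pmf R"
| "run_updates M P c ses \<nu> f A seed H R (Suc i) =
     bind_pmf (run_updates M P c ses \<nu> f A seed H R i) (update_step M P c ses \<nu> f A seed H i)"

text \<open>
  One session of the protocol with \<open>n\<close> updates: \<open>ses\<close> is the session material, \<open>prog\<close> the measured
  prover program.
\<close>

definition certified_run ::
  "('s, 'd) model \<Rightarrow> ('s, 'd, 'b) primitives \<Rightarrow> config \<Rightarrow> bits \<Rightarrow> bits \<Rightarrow> bits
     \<Rightarrow> ('s, 'd) transition \<Rightarrow> params \<Rightarrow> 's \<Rightarrow> ('s, 'd) trainer \<Rightarrow> nat \<Rightarrow> ('s, 'd) run pmf" where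
  "certified_run M P c ses prog \<nu> f \<theta>0 s0 A n =
     do {
       seed \<leftarrow> seed_dist P;
       H \<leftarrow> hidden_pmf M c n;
       R \<leftarrow> start_session P c ses prog \<nu> f \<theta>0 s0 seed;
       run_updates M P c ses \<nu> f A seed H R n
     }"

text \<open>\<open>I\<^sub>f\<close>: the number of recorded transitions that differ from \<open>f\<close>.\<close>

definition incorrect_updates :: "('s, 'd) transition \<Rightarrow> ('s, 'd) run \<Rightarrow> nat" where
  "incorrect_updates f R =
     card {i \<in> {..<length (batches R)}.
       (thetas R ! Suc i, opts R ! Suc i) \<noteq> f (thetas R ! i, opts R ! i, batches R ! i)}"

text \<open>\<open>\<theta>\<^sub>f \<in> \<tau>\<close>: some update record of the tape carries a checkpoint, released for \<open>\<theta>\<^sub>f\<close>.\<close>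

definition bound_to_ckpt :: "params \<Rightarrow> ('s, 'd) run \<Rightarrow> bool" where
  "bound_to_ckpt \<theta>f R \<longleftrightarrow>
     (\<exists>i < length (batches R). ckpt (updates (run_tape R) ! i) \<noteq> None \<and> thetas R ! Suc i = \<theta>f)"


section \<open>The verifier\<close>

text \<open>The verifier knows the engine through \<^const>\<open>root_vk\<close> and reads off the session material.\<close>

definition tape_root :: "tape \<Rightarrow> root_body" where
  "tape_root \<tau> = root_of (payload_of (\<tau> ! 0))"

definition tape_session :: "tape \<Rightarrow> bits" where
  "tape_session \<tau> = root_session (tape_root \<tau>)"

definition well_formed_tape :: "tape \<Rightarrow> bool" where
  "well_formed_tape \<tau> \<longleftrightarrow>
     2 \<le> length \<tau> \<and> is_Root (payload_of (\<tau> ! 0)) \<and> is_Measurement (payload_of (\<tau> ! 1)) \<and>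
     (\<forall>r \<in> set (drop 2 \<tau>). is_Update (payload_of r))"

definition root_attested :: "('s, 'd, 'b) primitives \<Rightarrow> tape \<Rightarrow> bool" where
  "root_attested P \<tau> \<longleftrightarrow>
     verify P (root_vk P) (h_root P (tape_session \<tau>) (tape_root \<tau>)) (root_sig (payload_of (\<tau> ! 0)))"

text \<open>The root signature covers the configuration and the first session key.\<close>

definition V_sig :: "('s, 'd, 'b) primitives \<Rightarrow> tape \<Rightarrow> config \<Rightarrow> bool" where
  "V_sig P \<tau> c \<longleftrightarrow>
     well_formed_tape \<tau> \<and> root_attested P \<tau> \<and> root_config (tape_root \<tau>) = c"

text \<open>Update \<open>i\<close> is record \<open>i + 2\<close> of the tape, hence its predecessor is record \<open>Suc i\<close>.\<close>

definition V_bind ::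
  "('s, 'd) model \<Rightarrow> ('s, 'd, 'b) primitives \<Rightarrow> tape \<Rightarrow> config \<Rightarrow> bits \<Rightarrow> params \<Rightarrow> bool" where
  "V_bind M P \<tau> c \<nu> \<theta>f \<longleftrightarrow>
     (let ses = tape_session \<tau>; us = updates \<tau>
      in \<exists>i < length us. \<exists>h vals.
           fst (u2 (us ! i)) = C_theta M P ses c (Suc i) \<theta>f \<and>
           ckpt (us ! i) = Some (h, vals) \<and>
           h = ckpt_hash P ses \<nu> (\<tau> ! Suc i) (us ! i) \<theta>f \<and>
           vals = ckpt_samples P ses c h \<theta>f)"

definition V_func :: "('s, 'd, 'b) primitives \<Rightarrow> tape \<Rightarrow> bits \<Rightarrow> bool" where
  "V_func P \<tau> hf \<longleftrightarrow> root_func (tape_root \<tau>) = hf \<and> root_attested P \<tau>"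

definition V_tape ::
  "('s, 'd, 'b) primitives \<Rightarrow> tape \<Rightarrow> bits \<Rightarrow> params \<Rightarrow> 's \<Rightarrow> bool" where
  "V_tape P \<tau> \<nu> \<theta>0 s0 \<longleftrightarrow>
     (let ses = tape_session \<tau>; us = updates \<tau>
      in well_formed_tape \<tau> \<and>
         (\<forall>k < length \<tau>.
            prev_hash (\<tau> ! k) = link_hash P ses (take k \<tau>) \<and>
            verify P (if k = 0 then root_vk0 (tape_root \<tau>) else next_vk (\<tau> ! (k - 1)))
              (h_sign P ses (payload_of (\<tau> ! k), prev_hash (\<tau> ! k), next_vk (\<tau> ! k)))
              (sig_of (\<tau> ! k))) \<and>
         root_nonce (tape_root \<tau>) = \<nu> \<and>
         root_init (tape_root \<tau>) = h_init P ses (ser P (SerInit \<theta>0 s0)) \<and>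
         (\<forall>i. Suc i < length us \<longrightarrow>
            fst (u2 (us ! i)) = fst (u1 (us ! Suc i)) \<and>
            snd (u2 (us ! i)) = fst (snd (u1 (us ! Suc i)))))"

definition V_replay ::
  "('s, 'd, 'b) primitives \<Rightarrow> tape \<Rightarrow> config \<Rightarrow> bits \<Rightarrow> bits \<Rightarrow> bool" where
  "V_replay P \<tau> c \<nu> hf \<longleftrightarrow>
     (let ses = tape_session \<tau>; us = updates \<tau>
      in \<forall>i < length us.
           u3 (us ! i) = challenge_value P ses \<nu> (\<tau> ! Suc i) (u1 (us ! i)) (u2 (us ! i)) \<and>
           (u4 (us ! i) \<noteq> None \<longleftrightarrow> u3 (us ! i) \<le> p_check c) \<and>
           (\<forall>rp. u4 (us ! i) = Some rp \<longrightarrow>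
              rp_sketch rp = fst (u2 (us ! i)) \<and>
              rp_state_agrees rp \<and>
              fst (rp_pair rp) = snd (rp_pair rp) \<and>
              rp_func rp = hf))"

definition verifier ::
  "('s, 'd) model \<Rightarrow> ('s, 'd, 'b) primitives
     \<Rightarrow> tape \<Rightarrow> config \<Rightarrow> bits \<Rightarrow> params \<Rightarrow> 's \<Rightarrow> bits \<Rightarrow> params \<Rightarrow> nat" where
  "verifier M P \<tau> c \<nu> \<theta>0 s0 hf \<theta>f =
     of_bool (V_sig P \<tau> c \<and> V_bind M P \<tau> c \<nu> \<theta>f \<and> V_func P \<tau> hf \<and>
              V_tape P \<tau> \<nu> \<theta>0 s0 \<and> V_replay P \<tau> c \<nu> hf)"

end

(*
  Every record the engine writes is a function of the transition it was shown, so along every run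
  of positive probability the tape satisfies an invariant describing the records through the
  submitted states, batches and hidden hash family.  Correctness of all transitions is needed only
  where a replay is compared with the declared outputs; adjacent commitments agree because both
  copies of a boundary state are hashed under the same index.  Hence acceptance holds on the whole
  support of the conditioning event.
*)

theory Submission
  imports Defs
begin

section \<open>The signed hash chain\<close>

text \<open>The verifier compares each signature only with the key announced one record earlier.
  Here both the announced and the signing keys are tied to the ratchet started from
  \<open>seed\<close>, so that the property extends record by record.\<close>

definition ratcheted_chain :: "('s, 'd, 'b) primitives \<Rightarrow> bits \<Rightarrow> bits \<Rightarrow> tape \<Rightarrow> bool" where
  "ratcheted_chain P ses seed \<tau> \<longleftrightarrow>
     (\<forall>k < length \<tau>.
        prev_hash (\<tau> ! k) = link_hash P ses (take k \<tau>) \<and>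
        next_vk (\<tau> ! k) = snd (session_key P ses seed (Suc k)) \<and>
        verify P (snd (session_key P ses seed k))
          (h_sign P ses (payload_of (\<tau> ! k), prev_hash (\<tau> ! k), next_vk (\<tau> ! k)))
          (sig_of (\<tau> ! k)))"

lemma ratcheted_chain_Nil: "ratcheted_chain P ses seed []"
  by (simp add: ratcheted_chain_def)

text \<open>Every key of the ratchet is an output of \<open>keygen\<close>, the first on the session
  seed and each later one on a hash, so the correctness clause for signatures covers them
  all.\<close>

lemma verify_session_signature:
  assumes "valid_primitives M P"
    and "\<sigma> \<in> set_pmf (sign P (fst (session_key P ses seed k)) msg)"
  shows "verify P (snd (session_key P ses seed k)) msg \<sigma>"
  using assms by (cases k) (auto simp: valid_primitives_def)

text \<open>Appending changes no prefix \<open>take k\<close> of the old tape, so old links survive;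
  the new record links to the old tape and is signed by the session key whose index is its
  own.\<close>

lemma append_record_cases:
  assumes "valid_primitives M P" and "ratcheted_chain P ses seed \<tau>"
    and "\<tau>' \<in> set_pmf (append_record P ses seed p \<tau>)"
  obtains r where "\<tau>' = \<tau> @ [r]" and "payload_of r = p" and "ratcheted_chain P ses seed \<tau>'"
proof -
  define h where "h = link_hash P ses \<tau>"
  define vk where "vk = snd (session_key P ses seed (Suc (length \<tau>)))"
  obtain \<sigma> where \<sigma>: "\<sigma> \<in> set_pmf (sign P (fst (session_key P ses seed (length \<tau>)))
      (h_sign P ses (p, h, vk)))" and \<tau>': "\<tau>' = \<tau> @ [Chained p h vk \<sigma>]"
    using assms(3) by (auto simp: append_record_def Let_def h_def vk_def)
  have "ratcheted_chain P ses seed \<tau>'"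
    using assms(2) verify_session_signature[OF assms(1) \<sigma>]
    unfolding ratcheted_chain_def \<tau>'
    by (auto simp: less_Suc_eq nth_append h_def vk_def simp del: session_key.simps)
  with \<tau>' show thesis by (intro that[of "Chained p h vk \<sigma>"]) auto
qed

section \<open>The recorded updates\<close>

text \<open>No equation between \<open>f\<close> and the declared outputs is imposed, so the
  engine's record qualifies whatever the trainer did. As the compared position is random, a replay
  is only located in the support of \<open>replay_update\<close>.\<close>

definition records_transition ::
  "('s, 'd) model \<Rightarrow> ('s, 'd, 'b) primitives \<Rightarrow> config \<Rightarrow> bits \<Rightarrow> bits \<Rightarrow> ('s, 'd) transition
     \<Rightarrow> hidden \<Rightarrow> nat \<Rightarrow> chained \<Rightarrow> params \<times> 's \<times> 'd \<Rightarrow> params \<times> 's \<Rightarrow> update \<Rightarrow> bool" where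
  "records_transition M P c ses \<nu> f H i prev = (\<lambda>(\<theta>, s, d) (\<theta>1, s1) u.
     u1 u = (C_theta M P ses c i \<theta>, C_s M P ses c H i s, C_d P ses d, F_d M c d) \<and>
     u2 u = (C_theta M P ses c (Suc i) \<theta>1, C_s M P ses c H (Suc i) s1) \<and>
     u3 u = challenge_value P ses \<nu> prev (u1 u) (u2 u) \<and>
     (u4 u \<noteq> None \<longleftrightarrow> u3 u \<le> p_check c) \<and>
     (\<forall>rp. u4 u = Some rp \<longrightarrow>
        rp \<in> set_pmf (replay_update M P c ses f i (\<theta>, s, d) (\<theta>1, s1))) \<and>
     (ckpt u \<noteq> None \<longrightarrow>
        ckpt u = Some (ckpt_hash P ses \<nu> prev u \<theta>1,
                       ckpt_samples P ses c (ckpt_hash P ses \<nu> prev u \<theta>1) \<theta>1)))"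

text \<open>With \<open>seed\<close> and \<open>H\<close> as explicit parameters, one draw of keys
  and hidden hashes serves all updates; adjacent commitments must use the same family.\<close>

definition faithful_run ::
  "('s, 'd) model \<Rightarrow> ('s, 'd, 'b) primitives \<Rightarrow> config \<Rightarrow> bits \<Rightarrow> bits \<Rightarrow> ('s, 'd) transition
     \<Rightarrow> params \<Rightarrow> 's \<Rightarrow> bits \<Rightarrow> hidden \<Rightarrow> nat \<Rightarrow> ('s, 'd) run \<Rightarrow> bool" where
  "faithful_run M P c ses \<nu> f \<theta>0 s0 seed H n R \<longleftrightarrow>
     (let \<tau> = run_tape R;
          body = RootBody ses \<nu> c (h_init P ses (ser P (SerInit \<theta>0 s0))) (h_func P ses f)
                   (snd (session_key P ses seed 0))
      in length (thetas R) = Suc n \<and> length (opts R) = Suc n \<and> length (batches R) = n \<and>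
         length \<tau> = n + 2 \<and> ratcheted_chain P ses seed \<tau> \<and>
         (\<exists>\<sigma>. payload_of (\<tau> ! 0) = Root body \<sigma> \<and>
              verify P (root_vk P) (h_root P ses body) \<sigma>) \<and>
         is_Measurement (payload_of (\<tau> ! 1)) \<and>
         (\<forall>i < n. \<exists>u. payload_of (\<tau> ! (i + 2)) = Update u \<and>
            records_transition M P c ses \<nu> f H i (\<tau> ! Suc i)
              (thetas R ! i, opts R ! i, batches R ! i) (thetas R ! Suc i, opts R ! Suc i) u))"

lemma faithful_run_start_session:
  assumes P: "valid_primitives M P"
    and R: "R \<in> set_pmf (start_session P c ses prog \<nu> f \<theta>0 s0 seed)"
  shows "faithful_run M P c ses \<nu> f \<theta>0 s0 seed H 0 R"
proof -
  define body where "body = RootBody ses \<nu> c (h_init P ses (ser P (SerInit \<theta>0 s0)))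
    (h_func P ses f) (snd (session_key P ses seed 0))"
  obtain \<sigma> \<tau>1 \<tau>2 where \<sigma>: "\<sigma> \<in> set_pmf (sign P (root_sk P) (h_root P ses body))"
    and \<tau>1: "\<tau>1 \<in> set_pmf (append_record P ses seed (Root body \<sigma>) [])"
    and \<tau>2: "\<tau>2 \<in> set_pmf (append_record P ses seed (Measurement (h_measure P ses prog)) \<tau>1)"
    and R_eq: "R = \<lparr>thetas = [\<theta>0], opts = [s0], batches = [], run_tape = \<tau>2\<rparr>"
    using R unfolding start_session_def Let_def body_def by auto
  obtain r1 where r1: "\<tau>1 = [] @ [r1]" "payload_of r1 = Root body \<sigma>"
    "ratcheted_chain P ses seed \<tau>1"
    using append_record_cases[OF P ratcheted_chain_Nil \<tau>1] .
  obtain r2 where r2: "\<tau>2 = \<tau>1 @ [r2]" "payload_of r2 = Measurement (h_measure P ses prog)"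
    "ratcheted_chain P ses seed \<tau>2"
    using append_record_cases[OF P r1(3) \<tau>2] .
  have "verify P (root_vk P) (h_root P ses body) \<sigma>"
    using P \<sigma> by (auto simp: valid_primitives_def)
  with r1 r2 show ?thesis
    unfolding faithful_run_def Let_def body_def[symmetric] R_eq by simp
qed

text \<open>Whatever the trainer submits, the engine itself computes the new record, and the earlier
  ones mention only list entries that appending does not disturb.\<close>

lemma faithful_run_update_step:
  assumes P: "valid_primitives M P"
    and R: "faithful_run M P c ses \<nu> f \<theta>0 s0 seed H n R"
    and R': "R' \<in> set_pmf (update_step M P c ses \<nu> f A seed H n R)"
  shows "faithful_run M P c ses \<nu> f \<theta>0 s0 seed H (Suc n) R'"
proof -
  let ?\<tau> = "run_tape R"
  define \<theta> where "\<theta> = last (thetas R)"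
  define s where "s = last (opts R)"
  define prev where "prev = last ?\<tau>"
  have len: "length (thetas R) = Suc n" "length (opts R) = Suc n" "length (batches R) = n"
    "length ?\<tau> = n + 2" and chain: "ratcheted_chain P ses seed ?\<tau>"
    using R by (auto simp: faithful_run_def Let_def)
  \<comment> \<open>The engine looks up the current state with \<open>last\<close>, the invariant by
    index. The root and measurement records shift the tape by two, so its last record has index
    \<open>Suc n\<close>.\<close>
  have last_eq: "thetas R ! n = \<theta>" "opts R ! n = s" "?\<tau> ! Suc n = prev"
    using len by (auto simp: \<theta>_def s_def prev_def last_conv_nth simp flip: length_greater_0_conv)
  obtain d \<theta>1 s1 c1 c2 v rp h released u \<tau>' where
    c1: "c1 = (C_theta M P ses c n \<theta>, C_s M P ses c H n s, C_d P ses d, F_d M c d)" and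
    c2: "c2 = (C_theta M P ses c (Suc n) \<theta>1, C_s M P ses c H (Suc n) s1)" and
    v: "v = challenge_value P ses \<nu> prev c1 c2" and
    rp: "rp \<in> set_pmf (if v \<le> p_check c
              then map_pmf Some (replay_update M P c ses f n (\<theta>, s, d) (\<theta>1, s1))
              else return_pmf None)" and
    h: "h = ckpt_hash P ses \<nu> prev (UpdateRec c1 c2 v rp None) \<theta>1" and
    u: "u = UpdateRec c1 c2 v rp (if released then Some (h, ckpt_samples P ses c h \<theta>1) else None)" and
    \<tau>': "\<tau>' \<in> set_pmf (append_record P ses seed (Update u) ?\<tau>)" and
    R'_eq: "R' = R\<lparr>thetas := thetas R @ [\<theta>1], opts := opts R @ [s1],
      batches := batches R @ [d], run_tape := \<tau>'\<rparr>"
    using R' unfolding update_step_def Let_def \<theta>_def[symmetric] s_def[symmetric] prev_def[symmetric]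
    by auto
  obtain r where r: "\<tau>' = ?\<tau> @ [r]" "payload_of r = Update u" "ratcheted_chain P ses seed \<tau>'"
    using append_record_cases[OF P chain \<tau>'] .
  \<comment> \<open>The hash \<open>h\<close> was computed while the checkpoint entry was still
    \<open>None\<close>; as \<open>ckpt_hash\<close> reads only \<open>u1\<close> to
    \<open>u4\<close>, it has the same value on the finished record \<open>u\<close>.\<close>
  have "records_transition M P c ses \<nu> f H n prev (\<theta>, s, d) (\<theta>1, s1) u"
    using rp unfolding records_transition_def u
    by (auto simp: c1 c2 v h ckpt_hash_def split: if_splits)
  then have "\<exists>u. payload_of (\<tau>' ! (i + 2)) = Update u \<and>
      records_transition M P c ses \<nu> f H i (\<tau>' ! Suc i)
        (thetas R' ! i, opts R' ! i, batches R' ! i) (thetas R' ! Suc i, opts R' ! Suc i) u"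
    if "i < Suc n" for i
    using R r(1,2) len last_eq that unfolding faithful_run_def Let_def R'_eq
    by (cases "i = n") (simp_all add: nth_append)
  then show ?thesis
    using R r(1,3) len unfolding faithful_run_def Let_def
    by (simp add: R'_eq nth_append)
qed

lemma faithful_run_certified_run:
  assumes P: "valid_primitives M P"
    and "R \<in> set_pmf (certified_run M P c ses prog \<nu> f \<theta>0 s0 A n)"
  obtains seed H where "faithful_run M P c ses \<nu> f \<theta>0 s0 seed H n R"
proof -
  obtain seed H R0 where R0: "R0 \<in> set_pmf (start_session P c ses prog \<nu> f \<theta>0 s0 seed)"
    and R: "R \<in> set_pmf (run_updates M P c ses \<nu> f A seed H R0 n)"
    using assms(2) by (auto simp: certified_run_def)
  from R have "faithful_run M P c ses \<nu> f \<theta>0 s0 seed H n R"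
    by (induction n arbitrary: R)
      (auto intro: faithful_run_start_session[OF P R0] faithful_run_update_step[OF P])
  then show thesis by (rule that)
qed

section \<open>Acceptance\<close>

text \<open>The recomputation returns exactly the declared outputs, so the recorded values agree
  whichever position is sampled.\<close>

lemma replay_of_correct_transition:
  assumes "rp \<in> set_pmf (replay_update M P c ses f i pre (\<theta>1, s1))" and "(\<theta>1, s1) = f pre"
  shows "rp_sketch rp = C_theta M P ses c (Suc i) \<theta>1" and "rp_state_agrees rp"
    and "fst (rp_pair rp) = snd (rp_pair rp)" and "rp_func rp = h_func P ses f"
  using assms(1) by (auto simp: replay_update_def simp flip: assms(2))

text \<open>The set of faulty indices is finite, so its cardinality vanishes only if it is
  empty.\<close>

lemma correct_transitions:
  assumes "incorrect_updates f R = 0" and "i < length (batches R)"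
  shows "(thetas R ! Suc i, opts R ! Suc i) = f (thetas R ! i, opts R ! i, batches R ! i)"
  using assms by (auto simp: incorrect_updates_def)

text \<open>This is the deterministic core, about a single run. Only the replay check draws on
  \<open>correct\<close>, and only the binding check on \<open>bound\<close>.\<close>

lemma verifier_accepts:
  assumes R: "faithful_run M P c ses \<nu> f \<theta>0 s0 seed H n R"
    and correct: "incorrect_updates f R = 0" and bound: "bound_to_ckpt \<theta>f R"
  shows "verifier M P (run_tape R) c \<nu> \<theta>0 s0 (h_func P ses f) \<theta>f = 1"
proof -
  define \<tau> where "\<tau> = run_tape R"
  define us where "us = updates \<tau>"
  define body where "body = RootBody ses \<nu> c (h_init P ses (ser P (SerInit \<theta>0 s0)))
    (h_func P ses f) (snd (session_key P ses seed 0))"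
  have len: "length (batches R) = n" "length \<tau> = n + 2"
    and chain: "ratcheted_chain P ses seed \<tau>"
    and measurement: "is_Measurement (payload_of (\<tau> ! 1))"
    using R by (auto simp: faithful_run_def Let_def \<tau>_def)
  obtain \<sigma> where root: "payload_of (\<tau> ! 0) = Root body \<sigma>"
    and \<sigma>: "verify P (root_vk P) (h_root P ses body) \<sigma>"
    using R by (auto simp: faithful_run_def Let_def \<tau>_def body_def)
  \<comment> \<open>The verifier takes the session material from the tape; it recovers the
    \<open>ses\<close> under which the engine hashed.\<close>
  have tape_root: "tape_root \<tau> = body" and ses: "tape_session \<tau> = ses"
    using root by (auto simp: tape_root_def tape_session_def body_def)
  have len_us: "length us = n"
    using len by (simp add: us_def updates_def)
  have upd: "is_Update (payload_of (\<tau> ! (i + 2)))"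
    and rec: "records_transition M P c ses \<nu> f H i (\<tau> ! Suc i)
      (thetas R ! i, opts R ! i, batches R ! i) (thetas R ! Suc i, opts R ! Suc i) (us ! i)"
    if "i < n" for i
  proof -
    have "\<exists>u. payload_of (\<tau> ! (i + 2)) = Update u \<and>
        records_transition M P c ses \<nu> f H i (\<tau> ! Suc i)
          (thetas R ! i, opts R ! i, batches R ! i) (thetas R ! Suc i, opts R ! Suc i) u"
      using R that by (simp add: faithful_run_def Let_def \<tau>_def)
    then obtain u where u: "payload_of (\<tau> ! (i + 2)) = Update u"
      "records_transition M P c ses \<nu> f H i (\<tau> ! Suc i)
        (thetas R ! i, opts R ! i, batches R ! i) (thetas R ! Suc i, opts R ! Suc i) u"
      by blast
    moreover have "us ! i = u"
      using u(1) len that by (simp add: us_def updates_def add.commute)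
    ultimately show "is_Update (payload_of (\<tau> ! (i + 2)))"
      "records_transition M P c ses \<nu> f H i (\<tau> ! Suc i)
        (thetas R ! i, opts R ! i, batches R ! i) (thetas R ! Suc i, opts R ! Suc i) (us ! i)"
      by auto
  qed
  have wf: "well_formed_tape \<tau>"
    using root measurement upd len
    by (auto simp: well_formed_tape_def in_set_conv_nth add.commute)
  have attested: "root_attested P \<tau>"
    using \<sigma> by (simp add: root_attested_def tape_root ses root)
  have sig: "V_sig P \<tau> c"
    using wf attested by (simp add: V_sig_def tape_root) (simp add: body_def)
  have func: "V_func P \<tau> (h_func P ses f)"
    using attested by (simp add: V_func_def tape_root) (simp add: body_def)
  have bind: "V_bind M P \<tau> c \<nu> \<theta>f"
  proof -
    \<comment> \<open>The record supplied by \<open>bound\<close> is the witness: its post-sketch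
      and checkpoint were computed from \<open>thetas R ! Suc i\<close>, which is
      \<open>\<theta>f\<close>.\<close>
    obtain i where i: "i < n" "ckpt (us ! i) \<noteq> None" "thetas R ! Suc i = \<theta>f"
      using bound len by (auto simp: bound_to_ckpt_def us_def \<tau>_def)
    then show ?thesis
      using rec[OF i(1)] unfolding V_bind_def Let_def ses us_def[symmetric] len_us
      by (intro exI[of _ i]) (auto simp: records_transition_def)
  qed
  have "verify P (if k = 0 then root_vk0 (tape_root \<tau>) else next_vk (\<tau> ! (k - 1)))
      (h_sign P ses (payload_of (\<tau> ! k), prev_hash (\<tau> ! k), next_vk (\<tau> ! k))) (sig_of (\<tau> ! k))"
    if "k < length \<tau>" for k
  proof -
    \<comment> \<open>Record 0 is checked against the key inside the root body, every later one
      against the key announced by its predecessor; either way this is entry \<open>k\<close> of the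
      ratchet.\<close>
    have "(if k = 0 then root_vk0 (tape_root \<tau>) else next_vk (\<tau> ! (k - 1)))
        = snd (session_key P ses seed k)"
      using chain that unfolding ratcheted_chain_def
      by (cases k) (simp_all add: tape_root body_def del: session_key.simps)
    moreover have "verify P (snd (session_key P ses seed k))
        (h_sign P ses (payload_of (\<tau> ! k), prev_hash (\<tau> ! k), next_vk (\<tau> ! k))) (sig_of (\<tau> ! k))"
      using chain that unfolding ratcheted_chain_def by blast
    ultimately show ?thesis by (simp only:)
  qed
  \<comment> \<open>Both sides commit to the boundary state \<open>Suc i\<close>, under the same
    boundary index and the same hidden hashes.\<close>
  moreover have "fst (u2 (us ! i)) = fst (u1 (us ! Suc i)) \<and>
      snd (u2 (us ! i)) = fst (snd (u1 (us ! Suc i)))" if "Suc i < n" for i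
    using rec[of i] rec[of "Suc i"] that by (auto simp: records_transition_def)
  ultimately have tape: "V_tape P \<tau> \<nu> \<theta>0 s0"
    using wf chain unfolding V_tape_def Let_def ses us_def[symmetric] len_us
    by (auto simp: ratcheted_chain_def tape_root body_def simp del: session_key.simps)
  have replay: "V_replay P \<tau> c \<nu> (h_func P ses f)"
    unfolding V_replay_def Let_def ses us_def[symmetric] len_us
  proof (intro allI impI conjI)
    fix i assume i: "i < n"
    show "u3 (us ! i) = challenge_value P ses \<nu> (\<tau> ! Suc i) (u1 (us ! i)) (u2 (us ! i))"
      and "u4 (us ! i) \<noteq> None \<longleftrightarrow> u3 (us ! i) \<le> p_check c"
      using rec[OF i] by (auto simp: records_transition_def)
    fix rp assume "u4 (us ! i) = Some rp"
    with rec[OF i] have rp: "rp \<in> set_pmf (replay_update M P c ses f i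
        (thetas R ! i, opts R ! i, batches R ! i) (thetas R ! Suc i, opts R ! Suc i))"
      and "fst (u2 (us ! i)) = C_theta M P ses c (Suc i) (thetas R ! Suc i)"
      by (auto simp: records_transition_def)
    with replay_of_correct_transition[OF rp correct_transitions[OF correct]] i len
    show "rp_sketch rp = fst (u2 (us ! i))" "rp_state_agrees rp"
      "fst (rp_pair rp) = snd (rp_pair rp)" "rp_func rp = h_func P ses f"
      by auto
  qed
  show ?thesis
    using sig bind func tape replay by (simp add: verifier_def \<tau>_def)
qed

theorem theorem5p1:
  fixes M :: "('s, 'd) model" and P :: "('s, 'd, 'b) primitives" and c :: config
    and ses prog \<nu> :: bits and f :: "('s, 'd) transition"
    and \<theta>0 \<theta>f :: params and s0 :: 's and A :: "('s, 'd) trainer" and n :: nat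
  assumes "valid_model M" and "valid_primitives M P" and "valid_config M c"
    and "f \<in> Params M \<times> States M \<times> Batches M \<rightarrow> Params M \<times> States M"
    and "\<theta>0 \<in> Params M" and "s0 \<in> States M" and "\<theta>f \<in> Params M"
    and "admissible_trainer M A"
    and "\<P>(R in certified_run M P c ses prog \<nu> f \<theta>0 s0 A n.
           incorrect_updates f R = 0 \<and> bound_to_ckpt \<theta>f R) > 0"
  shows "\<P>(R in certified_run M P c ses prog \<nu> f \<theta>0 s0 A n.
           verifier M P (run_tape R) c \<nu> \<theta>0 s0 (h_func P ses f) \<theta>f = 1
           \<bar> incorrect_updates f R = 0 \<and> bound_to_ckpt \<theta>f R) = 1"
proof -
  let ?D = "certified_run M P c ses prog \<nu> f \<theta>0 s0 A n"
  let ?V = "\<lambda>R. verifier M P (run_tape R) c \<nu> \<theta>0 s0 (h_func P ses f) \<theta>f = 1"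
  let ?E = "\<lambda>R. incorrect_updates f R = 0 \<and> bound_to_ckpt \<theta>f R"
  have "?V R" if "R \<in> set_pmf ?D" "?E R" for R
    using faithful_run_certified_run[OF assms(2) that(1)] verifier_accepts that(2) by metis
  \<comment> \<open>A \<open>pmf\<close> is concentrated on its support, where the two events
    coincide.\<close>
  then have "\<P>(R in ?D. ?V R \<and> ?E R) = \<P>(R in ?D. ?E R)"
    by (intro measure_pmf.finite_measure_eq_AE) (auto simp: AE_measure_pmf_iff)
  \<comment> \<open>\<open>cond_prob\<close> is a quotient, and division by zero yields 0 in HOL;
    positivity of the conditioning event makes the quotient of equal measures 1.\<close>
  then show ?thesis
    using assms(9) by (simp add: cond_prob_def)
qed

end
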